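(* Let $Q$ be an effect quantale and let $\mathsf{ProgramType}=\mathbb{P}(\mathsf{Typing})$ be the set of program types over $Q$, ordered by $\supseteq$, with concretization $$\gamma:\mathsf{ProgramType}\to\mathbb{P}(\mathbb{S}),\qquad \gamma(\overline{T})=\bigcap\{\gamma(\langle\Gamma,\tau,\chi\rangle)\mid\langle\Gamma,\tau,\chi\rangle\in\overline{T}\}$$ (the empty intersection being $\mathbb{S}$). Then $\gamma$ preserves meets: for every family $(\overline{T}_i)_{i\in\Delta}$ of program types, $$\gamma\Big(\bigcup_{i\in\Delta}\overline{T}_i\Big)=\bigcap_{i\in\Delta}\gamma(\overline{T}_i).$$ Consequently, with $$\alpha:\mathbb{P}(\mathbb{S})\to\mathsf{ProgramType},\qquad \alpha(S)=\bigcup\{\overline{T}\in\mathsf{ProgramType}\mid S\subseteq\gamma(\overline{T})\},$$ the pair $(\alpha,\gamma)$ is a Galois connection between $\langle\mathbb{P}(\mathbb{S}),\subseteq\rangle$ and $\langle\mathsf{ProgramType},\supseteq\rangle$, i.e. for all $S\subseteq\mathbb{S}$ and all $\overline{T}\in\mathsf{ProgramType}$, $$\alpha(S)\supseteq\overline{T}\iff S\subseteq\gamma(\overline{T}),$$ and $\alpha$ is the unique lower adjoint of $\gamma$.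
   Context: $\mathbb{P}(A)$ denotes the powerset of $A$, and $Q^*$ the set of finite sequences (traces) over $Q$. Effect quantale: a set $Q$ with a partial binary join $\sqcup$ (a partial operation that is idempotent, commutative and associative) and a partial monoid operation $\rhd$ with unit $I\in Q$, satisfying $x\rhd(y\sqcup z)=(x\rhd y)\sqcup(x\rhd z)$ and $(x\sqcup y)\rhd z=(x\rhd z)\sqcup(y\rhd z)$ (one side defined iff the other is, and then equal). The relation $x\sqsubseteq y\iff x\sqcup y=y$ is a partial order on $Q$. Semantic domains: $\mathbb{X}$ is a set of program variables. $\mathbb{V}$ is a fixed domain of values satisfying $\mathbb{V}\simeq\mathbb{W}_\bot\oplus\mathbb{U}_\bot\oplus[\mathbb{V}\to\mathbb{P}(\mathbb{V}\times Q^* )]_\bot$, where $\mathbb{W}=\{\omega\}$ (error), $\mathbb{U}=\{\mathsf{tt}\}$ (unit), $\oplus$ is the coalesced sum, $(-)_\bot$ is lifting, and $[-\to-]$ is the domain-theoretic function space. So a value is $\bot$, the error value, the unit value $\mathsf{tt}$, or a function value $f$, which can be applied to any $v\in\mathbb{V}$ to give a set $f\,v\in\mathbb{P}(\mathbb{V}\times Q^* )$ of value-trace pairs. $\mathbb{R}$ is the set of environments, i.e. (partial) functions from $\mathbb{X}$ to $\mathbb{V}$. $\mathbb{S}=\mathbb{R}\to\mathbb{P}(\mathbb{V}\times Q^* )$ is the set of all functions from environments to sets of value-trace pairs. Types: $\tau::=\mathsf{unit}\mid\tau\xrightarrow{\chi}\tau'$ with $\chi\in Q$. Type environments: $\Gamma::=\epsilon\mid\Gamma,x{:}\tau$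 with $x\in\mathbb{X}$. $\mathsf{Typing}=\mathsf{TypeEnvironment}\times\mathsf{Type}\times Q$. Concretizations (all written $\gamma$): - Effects: for $\chi\in Q$, $\gamma(\chi)\subseteq Q^*$ is the set of traces $T=\chi_1\cdots\chi_n$ whose product $\chi_1\rhd\cdots\rhd\chi_n$ (equal to $I$ if $n=0$) is defined in $Q$ and is $\sqsubseteq\chi$. - Types: $\gamma(\mathsf{unit})=\{\mathsf{tt}\}$, and $\gamma(\tau\xrightarrow{\chi}\tau')$ is the set of function values $f\in\mathbb{V}$ such that $f\,v\subseteq\gamma(\tau')\times\gamma(\chi)$ for all $v\in\gamma(\tau)$. - Type environments: $\gamma(\epsilon)=\{\emptyset\}$ (the singleton of the empty function), and $\gamma(\Gamma,x{:}\tau)=\{R'[x\mapsto v]\mid R'\in\gamma(\Gamma),\ v\in\gamma(\tau)\}$. - Typings: $\gamma(\langle\Gamma,\tau,\chi\rangle)=\{\phi\in\mathbb{S}\mid\forall R\in\gamma(\Gamma).\ \phi(R)\subseteq\gamma(\tau)\times\gamma(\chi)\}$.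
   Formalization: By Cantor's theorem no domain V satisfies the stated equation with the full powerset, since constant functions are continuous; the formal version lets function values map continuously into any chain-complete pointed order whose elements are distinct sets of value-trace pairs. *)

theory Defs
  imports Main "HOL-Library.Complete_Partial_Order2"
begin

section \<open>Effect quantales\<close>

text \<open>
  The underlying set of the effect quantale is the type \<open>'q\<close>. Partial operations return
  \<open>None\<close> where they are undefined, and \<open>Option.bind\<close> composes them strictly, so that an
  equation between composites says that one side is defined iff the other is, and that
  they are then equal.
\<close>

record 'q effect_ops =
  ejoin :: "'q \<Rightarrow> 'q \<Rightarrow> 'q option"
  eseq :: "'q \<Rightarrow> 'q \<Rightarrow> 'q option"
  eunit :: 'q

definition effect_quantale :: "'q effect_ops \<Rightarrow> bool" where
  "effect_quantale Q \<longleftrightarrow>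
     (\<forall>x. ejoin Q x x = Some x) \<and>
     (\<forall>x y. ejoin Q x y = ejoin Q y x) \<and>
     (\<forall>x y z. Option.bind (ejoin Q x y) (\<lambda>u. ejoin Q u z)
            = Option.bind (ejoin Q y z) (\<lambda>u. ejoin Q x u)) \<and>
     (\<forall>x. eseq Q (eunit Q) x = Some x) \<and>
     (\<forall>x. eseq Q x (eunit Q) = Some x) \<and>
     (\<forall>x y z. Option.bind (eseq Q x y) (\<lambda>u. eseq Q u z)
            = Option.bind (eseq Q y z) (\<lambda>u. eseq Q x u)) \<and>
     (\<forall>x y z. Option.bind (ejoin Q y z) (\<lambda>u. eseq Q x u)
            = Option.bind (eseq Q x y) (\<lambda>u. Option.bind (eseq Q x z) (\<lambda>w. ejoin Q u w))) \<and>
     (\<forall>x y z. Option.bind (ejoin Q x y) (\<lambda>u. eseq Q u z)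
            = Option.bind (eseq Q x z) (\<lambda>u. Option.bind (eseq Q y z) (\<lambda>w. ejoin Q u w)))"

definition ele :: "'q effect_ops \<Rightarrow> 'q \<Rightarrow> 'q \<Rightarrow> bool" where
  "ele Q x y \<longleftrightarrow> ejoin Q x y = Some y"

fun trace_prod :: "'q effect_ops \<Rightarrow> 'q list \<Rightarrow> 'q option" where
  "trace_prod Q [] = Some (eunit Q)"
| "trace_prod Q (c # cs) = Option.bind (trace_prod Q cs) (\<lambda>u. eseq Q c u)"

lemma ele_refl: "effect_quantale Q \<Longrightarrow> ele Q x x"
  by (simp add: effect_quantale_def ele_def)

lemma ele_antisym: "effect_quantale Q \<Longrightarrow> ele Q x y \<Longrightarrow> ele Q y x \<Longrightarrow> x = y"
  unfolding effect_quantale_def ele_def by (metis option.inject)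

lemma ele_trans:
  assumes "effect_quantale Q" "ele Q x y" "ele Q y z"
  shows "ele Q x z"
proof -
  have "Option.bind (ejoin Q x y) (\<lambda>u. ejoin Q u z) = Option.bind (ejoin Q y z) (\<lambda>u. ejoin Q x u)"
    using assms(1) unfolding effect_quantale_def by blast
  then show ?thesis using assms(2,3) by (simp add: ele_def)
qed


section \<open>Values\<close>

text \<open>
  \<open>'f val_sum\<close> is the underlying set of the coalesced sum of the liftings of \<open>{\<omega>}\<close>,
  \<open>{tt}\<close> and \<open>'f\<close>: the three bottoms are identified to \<open>Bot\<close>, elements of
  different summands are incomparable, and \<open>'f\<close> keeps its own order.
\<close>

datatype 'f val_sum = Bot | Err | TT | Fn 'f

fun sum_le :: "'f::ord val_sum \<Rightarrow> 'f val_sum \<Rightarrow> bool" where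
  "sum_le Bot b = True"
| "sum_le Err b = (b = Err)"
| "sum_le TT b = (b = TT)"
| "sum_le (Fn f) b = (\<exists>g. b = Fn g \<and> f \<le> g)"

text \<open>
  Both \<open>'v\<close> (the values) and \<open>'p\<close> (the codomain of function values) are complete
  partial orders. \<open>'p\<close> stands for the powerdomain of \<open>'v \<times> 'q list\<close>, each of whose elements
  \<open>p\<close> is identified with a set \<open>elems D p\<close> of value-trace pairs. Neither the collection of
  the sets so obtained nor its order is fixed: the choice \<open>'p = ('v \<times> 'q list) set\<close>,
  \<open>elems = id\<close> is included in the definition, but, as the lemma
  \<open>value_domain_not_full_powerset\<close> below shows, taking all sets makes the
  domain equation unsolvable for cardinality reasons, whatever their order.

  \<open>unfold_val\<close> is the isomorphism of the domain equation.
\<close>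

record ('v, 'q, 'p) value_ops =
  unfold_val :: "'v \<Rightarrow> ('v \<Rightarrow> 'p) val_sum"
  elems :: "'p \<Rightarrow> ('v \<times> 'q list) set"

definition cont_funs :: "('v::ccpo \<Rightarrow> 'p::ccpo) set" where
  "cont_funs = {f. mcont Sup (\<le>) Sup (\<le>) f}"

definition value_domain :: "('v::ccpo, 'q, 'p::ccpo) value_ops \<Rightarrow> bool" where
  "value_domain D \<longleftrightarrow>
     bij_betw (unfold_val D) UNIV ({Bot, Err, TT} \<union> Fn ` cont_funs) \<and>
     (\<forall>a b. a \<le> b \<longleftrightarrow> sum_le (unfold_val D a) (unfold_val D b)) \<and>
     inj (elems D)"

lemma const_in_cont_funs: "(\<lambda>_. c) \<in> cont_funs"
  by (simp add: cont_funs_def mcont_def cont_def monotone_def image_constant_conv)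

lemma value_domain_not_full_powerset:
  assumes D: "value_domain D"
  shows "\<not> surj (elems D)"
proof
  assume s: "surj (elems D)"
  define p where "p = (\<lambda>A. inv (elems D) ((\<lambda>v. (v, [])) ` A))"
  define g where "g = (\<lambda>A. inv (unfold_val D) (Fn (\<lambda>_. p A)))"
  have "p A = p B \<Longrightarrow> A = B" for A B
    using s unfolding p_def by (metis (no_types, lifting) inj_def inj_image_eq_iff prod.inject surj_f_inv_f)
  moreover have "unfold_val D (g A) = Fn (\<lambda>_. p A)" for A
  proof -
    have "Fn (\<lambda>_. p A) \<in> range (unfold_val D)"
      using D const_in_cont_funs unfolding value_domain_def bij_betw_def by blast
    then show ?thesis unfolding g_def by (rule f_inv_into_f)
  qed
  ultimately have "inj g"
    by (metis injI val_sum.inject)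
  then have "surj (inv g)" by (rule inj_imp_surj_inv)
  then show False by (metis Cantors_theorem surj_def Pow_UNIV)
qed

definition is_tt :: "('v, 'q, 'p) value_ops \<Rightarrow> 'v \<Rightarrow> bool" where
  "is_tt D v \<longleftrightarrow> unfold_val D v = TT"

definition is_fun :: "('v, 'q, 'p) value_ops \<Rightarrow> 'v \<Rightarrow> bool" where
  "is_fun D f \<longleftrightarrow> (\<exists>g. unfold_val D f = Fn g)"

text \<open>Application is only meaningful if the first value is a function value.\<close>

definition app :: "('v, 'q, 'p) value_ops \<Rightarrow> 'v \<Rightarrow> 'v \<Rightarrow> ('v \<times> 'q list) set" where
  "app D f v = (case unfold_val D f of Fn g \<Rightarrow> elems D (g v) | _ \<Rightarrow> undefined)"

type_synonym ('x, 'v) env = "'x \<rightharpoonup> 'v"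
type_synonym ('x, 'v, 'q) sem = "('x, 'v) env \<Rightarrow> ('v \<times> 'q list) set"


section \<open>Types and typings\<close>

datatype 'q ty = Unit | Arrow "'q ty" 'q "'q ty"

datatype ('x, 'q) tyenv = Empty | Ext "('x, 'q) tyenv" 'x "'q ty"

type_synonym ('x, 'q) typing = "('x, 'q) tyenv \<times> 'q ty \<times> 'q"

type_synonym ('x, 'q) program_type = "('x, 'q) typing set"


section \<open>Concretizations and abstraction\<close>

definition conc_eff :: "'q effect_ops \<Rightarrow> 'q \<Rightarrow> 'q list set" where
  "conc_eff Q \<chi> = {T. \<exists>u. trace_prod Q T = Some u \<and> ele Q u \<chi>}"

primrec conc_ty :: "'q effect_ops \<Rightarrow> ('v, 'q, 'p) value_ops \<Rightarrow> 'q ty \<Rightarrow> 'v set" where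
  "conc_ty Q D Unit = {v. is_tt D v}"
| "conc_ty Q D (Arrow \<tau> \<chi> \<tau>') =
     {f. is_fun D f \<and> (\<forall>v\<in>conc_ty Q D \<tau>. app D f v \<subseteq> conc_ty Q D \<tau>' \<times> conc_eff Q \<chi>)}"

primrec conc_env ::
    "'q effect_ops \<Rightarrow> ('v, 'q, 'p) value_ops \<Rightarrow> ('x, 'q) tyenv \<Rightarrow> ('x, 'v) env set" where
  "conc_env Q D Empty = {Map.empty}"
| "conc_env Q D (Ext \<Gamma> x \<tau>) = {R(x \<mapsto> v) | R v. R \<in> conc_env Q D \<Gamma> \<and> v \<in> conc_ty Q D \<tau>}"

fun conc_typing ::
    "'q effect_ops \<Rightarrow> ('v, 'q, 'p) value_ops \<Rightarrow> ('x, 'q) typing \<Rightarrow> ('x, 'v, 'q) sem set" where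
  "conc_typing Q D (\<Gamma>, \<tau>, \<chi>) =
     {\<phi>. \<forall>R\<in>conc_env Q D \<Gamma>. \<phi> R \<subseteq> conc_ty Q D \<tau> \<times> conc_eff Q \<chi>}"

definition conc ::
    "'q effect_ops \<Rightarrow> ('v, 'q, 'p) value_ops \<Rightarrow> ('x, 'q) program_type \<Rightarrow> ('x, 'v, 'q) sem set" where
  "conc Q D T = \<Inter> {conc_typing Q D (\<Gamma>, \<tau>, \<chi>) | \<Gamma> \<tau> \<chi>. (\<Gamma>, \<tau>, \<chi>) \<in> T}"

definition abst ::
    "'q effect_ops \<Rightarrow> ('v, 'q, 'p) value_ops \<Rightarrow> ('x, 'v, 'q) sem set \<Rightarrow> ('x, 'q) program_type" where
  "abst Q D S = \<Union> {T. S \<subseteq> conc Q D T}"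

end

theory Submission
  imports Defs
begin

text \<open>Let \<open>\<phi>\<close> be related to a typing \<open>t\<close> when
  \<open>\<phi> \<in> conc_typing Q D t\<close>. Then \<open>conc\<close> and \<open>abst\<close>
  are the two polars of this relation (\<open>mem_conc_iff\<close>, \<open>mem_abst_iff\<close>). A
  condition on every element of a union is the conjunction of the conditions on its parts, so unions
  become intersections. Both sides of the adjunction say that every element of \<open>S\<close> is
  related to every element of \<open>T\<close>.\<close>

lemma mem_conc_iff: "\<phi> \<in> conc Q D T \<longleftrightarrow> (\<forall>t\<in>T. \<phi> \<in> conc_typing Q D t)"
  unfolding conc_def by fast

lemma conc_UN: "conc Q D (\<Union>i\<in>\<Delta>. T i) = (\<Inter>i\<in>\<Delta>. conc Q D (T i))"
  by (auto simp: mem_conc_iff)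

text \<open>If \<open>t\<close> lies in some \<open>T\<close> with
  \<open>S \<subseteq> conc Q D T\<close>, then the singleton \<open>{t}\<close> is already such a
  program type. The union defining \<open>abst\<close> can thus be tested one typing at a
  time.\<close>

lemma mem_abst_iff: "t \<in> abst Q D S \<longleftrightarrow> S \<subseteq> conc_typing Q D t"
proof
  assume "t \<in> abst Q D S"
  then show "S \<subseteq> conc_typing Q D t"
    unfolding abst_def by (auto simp: mem_conc_iff subset_iff)
next
  assume "S \<subseteq> conc_typing Q D t"
  then have "S \<subseteq> conc Q D {t}"
    by (auto simp: mem_conc_iff)
  then show "t \<in> abst Q D S"
    unfolding abst_def by blast
qed

lemma abst_conc_galois: "T \<subseteq> abst Q D S \<longleftrightarrow> S \<subseteq> conc Q D T"
  unfolding subset_iff mem_abst_iff mem_conc_iff by blast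

text \<open>By the two equivalences, \<open>\<alpha>' S\<close> and \<open>abst Q D S\<close> have
  the same subsets \<open>T\<close>, so each contains the other.\<close>

lemma abst_unique:
  assumes "\<And>S T. T \<subseteq> \<alpha>' S \<longleftrightarrow> S \<subseteq> conc Q D T"
  shows "\<alpha>' = abst Q D"
proof (rule ext)
  show "\<alpha>' S = abst Q D S" for S
    using assms[of _ S] abst_conc_galois[of _ Q D S] by blast
qed

theorem mainTheorem2:
  fixes Q :: "'q effect_ops"
    and D :: "('v::ccpo, 'q, 'p::ccpo) value_ops"
  assumes "effect_quantale Q"
    and "value_domain D"
  shows "(\<forall>(\<Delta> :: 'i set) (T :: 'i \<Rightarrow> ('x, 'q) program_type).
            conc Q D (\<Union>i\<in>\<Delta>. T i) = (\<Inter>i\<in>\<Delta>. conc Q D (T i)))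
       \<and> (\<forall>(S :: ('x, 'v, 'q) sem set) (T :: ('x, 'q) program_type).
            abst Q D S \<supseteq> T \<longleftrightarrow> S \<subseteq> conc Q D T)
       \<and> (\<forall>\<alpha>' :: ('x, 'v, 'q) sem set \<Rightarrow> ('x, 'q) program_type.
            (\<forall>S T. \<alpha>' S \<supseteq> T \<longleftrightarrow> S \<subseteq> conc Q D T) \<longrightarrow> \<alpha>' = abst Q D)"
  by (intro conjI allI impI conc_UN abst_conc_galois abst_unique) blast

end
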